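(* Let $(\Omega,\mathcal{F},P)$ be a probability space carrying binary random variables $X$ and $Z$, binary potential outcome random variables $Y_{(X,Z)=(x,z)}$ for $(x,z)\in\{0,1\}^2$, and the observable random variable $Y(\omega)=\sum_{x}\sum_{z} I_{(X,Z)=(x,z)}(\omega)\,Y_{(X,Z)=(x,z)}(\omega)$, where $I_{(X,Z)=(x,z)}$ is the indicator of the event $\{X=x,\,Z=z\}$. Let $(\tilde\Omega,\tilde{\mathcal F},\tilde P)$, $\tilde X$, $\tilde Y$, $\tilde Z$ be the probability space and random variables produced by a joint experimental randomization of $X$ and $Z$. Then for each $(x,z)\in\{0,1\}^2$, $$P_{Y_{(X,Z)=(x,z)}}=P_{\tilde Y\mid(\tilde X=x,\tilde Z=z)},$$ that is, for every $y$, $P(Y_{(X,Z)=(x,z)}=y)=\tilde P(\tilde Y=y\mid \tilde X=x,\tilde Z=z)$.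
   Context: Binary random variables take values in $\{0,1\}$. A joint experimental randomization of $X$ and $Z$ is the following construction. Let $(\Omega_R,\mathcal{F}_R,P_R)$ be an arbitrary probability space carrying $\{0,1\}$-valued random variables $X_R$ and $Z_R$ (not necessarily independent of each other) such that $P_{(X_R,Z_R)}(x,z)=P_R(X_R=x,Z_R=z)\in(0,1)$ for all $(x,z)\in\{0,1\}^2$. Define the product probability space $$(\tilde\Omega,\tilde{\mathcal F},\tilde P)=(\Omega\times\Omega_R,\ \mathcal F\times\mathcal F_R,\ P\times P_R)$$ and, for $\tilde\omega=(\omega,\omega_R)\in\tilde\Omega$, $$\tilde X(\tilde\omega)=X_R(\omega_R),\qquad \tilde Z(\tilde\omega)=Z_R(\omega_R),\qquad \tilde Y(\tilde\omega)=\sum_x\sum_z \tilde I_{(\tilde X,\tilde Z)=(x,z)}(\omega_R)\,Y_{(X,Z)=(x,z)}(\omega),$$ where $\tilde I_{(\tilde X,\tilde Z)=(x,z)}(\omega_R)$ is the indicator of the event $\{X_R=x,\ Z_R=z\}$. $P_W$ denotes the probability law of a random variable $W$, $P_W(w)=P(W=w)$, and conditional laws of discrete random variables are defined by the usual ratio of probabilities. *)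

theory Defs
  imports "HOL-Probability.Probability"
begin

definition binary_rv :: "'a measure \<Rightarrow> ('a \<Rightarrow> nat) \<Rightarrow> bool" where
  "binary_rv M V \<longleftrightarrow> V \<in> M \<rightarrow>\<^sub>M count_space {0, 1}"

definition law :: "'a measure \<Rightarrow> ('a \<Rightarrow> nat) \<Rightarrow> nat measure" where
  "law M V = distr M (count_space {0, 1}) V"

text \<open>Since \<^term>\<open>uniform_measure M A\<close> assigns \<open>P(A \<inter> B) / P(A)\<close> to an event \<open>B\<close>,
  this is the law under the elementary conditional probability given \<open>C\<close>.\<close>

definition cond_law :: "'a measure \<Rightarrow> ('a \<Rightarrow> nat) \<Rightarrow> ('a \<Rightarrow> bool) \<Rightarrow> nat measure" where
  "cond_law M V C = law (uniform_measure M {\<omega> \<in> space M. C \<omega>}) V"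

text \<open>\<open>Yp x z\<close> is the potential outcome under the assignment \<open>(X, Z) = (x, z)\<close>; only the
  values \<open>x, z \<in> {0, 1}\<close> matter.\<close>

definition observed_outcome ::
  "'a measure \<Rightarrow> ('a \<Rightarrow> nat) \<Rightarrow> ('a \<Rightarrow> nat) \<Rightarrow> (nat \<Rightarrow> nat \<Rightarrow> 'a \<Rightarrow> nat) \<Rightarrow> 'a \<Rightarrow> nat" where
  "observed_outcome M X Z Yp \<omega> =
    (\<Sum>x\<in>{0, 1}. \<Sum>z\<in>{0, 1}. indicator {\<omega> \<in> space M. X \<omega> = x \<and> Z \<omega> = z} \<omega> * Yp x z \<omega>)"

definition joint_randomizer :: "'b measure \<Rightarrow> ('b \<Rightarrow> nat) \<Rightarrow> ('b \<Rightarrow> nat) \<Rightarrow> bool" where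
  "joint_randomizer R XR ZR \<longleftrightarrow>
    prob_space R \<and> binary_rv R XR \<and> binary_rv R ZR \<and>
    (\<forall>x\<in>{0, 1}. \<forall>z\<in>{0, 1}. \<P>(\<omega> in R. XR \<omega> = x \<and> ZR \<omega> = z) \<in> {0<..<1})"

definition rand_space :: "'a measure \<Rightarrow> 'b measure \<Rightarrow> ('a \<times> 'b) measure" where
  "rand_space M R = M \<Otimes>\<^sub>M R"

definition rand_assignment :: "('b \<Rightarrow> nat) \<Rightarrow> 'a \<times> 'b \<Rightarrow> nat" where
  "rand_assignment V = (\<lambda>(\<omega>, \<omega>R). V \<omega>R)"

definition rand_outcome ::
  "'b measure \<Rightarrow> ('b \<Rightarrow> nat) \<Rightarrow> ('b \<Rightarrow> nat) \<Rightarrow> (nat \<Rightarrow> nat \<Rightarrow> 'a \<Rightarrow> nat) \<Rightarrow> 'a \<times> 'b \<Rightarrow> nat" where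
  "rand_outcome R XR ZR Yp = (\<lambda>(\<omega>, \<omega>R).
    \<Sum>x\<in>{0, 1}. \<Sum>z\<in>{0, 1}. indicator {\<omega>R \<in> space R. XR \<omega>R = x \<and> ZR \<omega>R = z} \<omega>R * Yp x z \<omega>)"

end

theory Submission
  imports Defs
begin

text \<open>On the event that the randomizer selects \<open>(x, z)\<close>, the randomized outcome is the potential
  outcome \<open>Yp x z\<close> evaluated in the first coordinate. Hence intersecting an event of the outcome
  with this selection event gives a measurable rectangle, and in the product measure the
  probability of the selection event cancels.\<close>

lemma binary_rv_range:
  assumes "binary_rv M V" "\<omega> \<in> space M"
  shows "V \<omega> \<in> {0, 1}"
  using measurable_space[OF assms(1)[unfolded binary_rv_def] assms(2)] by simp

text \<open>Values outside {0, 1} are never taken on the space, so cutting \<open>B\<close> down to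
  {0, 1} does not change the preimage. Allowing any set of naturals here lets point events be
  treated for every \<open>y\<close>, binary or not.\<close>

lemma binary_rv_sets:
  assumes "binary_rv M V"
  shows "{\<omega> \<in> space M. V \<omega> \<in> B} \<in> sets M"
proof -
  have "{\<omega> \<in> space M. V \<omega> \<in> B} = V -` (B \<inter> {0, 1}) \<inter> space M"
    using binary_rv_range[OF assms] by auto
  then show ?thesis
    using measurable_sets[OF assms[unfolded binary_rv_def], of "B \<inter> {0, 1}"] by simp
qed

text \<open>Exactly one of the four indicators equals 1 at a given point of the randomizer space, so
  the double sum collapses to a single term.\<close>

lemma rand_outcome_eq:
  assumes "\<omega>R \<in> space R" "XR \<omega>R \<in> {0, 1}" "ZR \<omega>R \<in> {0, 1}"
  shows "rand_outcome R XR ZR Yp (\<omega>, \<omega>R) = Yp (XR \<omega>R) (ZR \<omega>R) \<omega>"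
proof -
  have "(\<Sum>x\<in>{0, 1}. \<Sum>z\<in>{0, 1}.
      indicator {\<omega>R \<in> space R. XR \<omega>R = x \<and> ZR \<omega>R = z} \<omega>R * Yp x z \<omega>) =
      (\<Sum>x\<in>{0, 1}. if x = XR \<omega>R then \<Sum>z\<in>{0, 1}. if z = ZR \<omega>R then Yp x z \<omega> else 0 else 0)"
    using assms(1) by (intro sum.cong refl) (auto simp: indicator_def intro!: sum.cong)
  also have "\<dots> = Yp (XR \<omega>R) (ZR \<omega>R) \<omega>"
    using assms(2,3) by (simp only: sum.delta finite.intros if_True)
  finally show ?thesis
    by (simp only: rand_outcome_def prod.case)
qed

text \<open>Fixing the assignment leaves an outcome that depends on the first coordinate alone,
  while the assignment depends on the second alone. The set \<open>B\<close> is kept general: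
  singletons serve measurability and the pointwise formula, and \<open>UNIV\<close> yields the
  conditioning event itself.\<close>

lemma rand_outcome_rectangle:
  assumes "x \<in> {0, 1}" "z \<in> {0, 1}"
  shows "{\<omega> \<in> space (rand_space M R). rand_outcome R XR ZR Yp \<omega> \<in> B \<and>
      rand_assignment XR \<omega> = x \<and> rand_assignment ZR \<omega> = z} =
    {\<omega> \<in> space M. Yp x z \<omega> \<in> B} \<times> {\<omega>R \<in> space R. XR \<omega>R = x \<and> ZR \<omega>R = z}"
  using assms by (auto simp: rand_space_def rand_assignment_def space_pair_measure rand_outcome_eq)

lemma binary_rv_sets_pair:
  assumes "binary_rv M V" "binary_rv M W"
  shows "{\<omega> \<in> space M. V \<omega> = a \<and> W \<omega> = b} \<in> sets M"
proof -
  have "{\<omega> \<in> space M. V \<omega> = a \<and> W \<omega> = b} =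
      {\<omega> \<in> space M. V \<omega> \<in> {a}} \<inter> {\<omega> \<in> space M. W \<omega> \<in> {b}}"
    by auto
  then show ?thesis
    using binary_rv_sets[OF assms(1), of "{a}"] binary_rv_sets[OF assms(2), of "{b}"]
    by (simp only: sets.Int)
qed

text \<open>The four possible assignments partition the product space, and on each piece the
  preimage of a point is a measurable rectangle. The target is finite and discrete, so preimages of
  points suffice.\<close>

lemma binary_rv_rand_outcome:
  assumes "\<And>x z. x \<in> {0, 1} \<Longrightarrow> z \<in> {0, 1} \<Longrightarrow> binary_rv M (Yp x z)"
    and "binary_rv R XR" "binary_rv R ZR"
  shows "binary_rv (rand_space M R) (rand_outcome R XR ZR Yp)"
proof -
  let ?N = "rand_space M R" and ?Y = "rand_outcome R XR ZR Yp"
  have eq: "?Y \<omega> = Yp (XR (snd \<omega>)) (ZR (snd \<omega>)) (fst \<omega>)"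
    and bin: "fst \<omega> \<in> space M" "XR (snd \<omega>) \<in> {0, 1}" "ZR (snd \<omega>) \<in> {0, 1}"
    if "\<omega> \<in> space ?N" for \<omega>
  proof -
    from that obtain a b where \<omega>: "\<omega> = (a, b)" "a \<in> space M" "b \<in> space R"
      unfolding rand_space_def space_pair_measure by (rule SigmaE)
    then show "fst \<omega> \<in> space M" "XR (snd \<omega>) \<in> {0, 1}" "ZR (snd \<omega>) \<in> {0, 1}"
      using binary_rv_range[OF assms(2)] binary_rv_range[OF assms(3)] by auto
    then show "?Y \<omega> = Yp (XR (snd \<omega>)) (ZR (snd \<omega>)) (fst \<omega>)"
      using \<omega> rand_outcome_eq[of b R XR ZR Yp a] by simp
  qed
  have "?Y -` {y} \<inter> space ?N \<in> sets ?N" for y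
  proof -
    have "?Y -` {y} \<inter> space ?N = (\<Union>x\<in>{0, 1}. \<Union>z\<in>{0, 1}.
        {\<omega> \<in> space ?N. ?Y \<omega> \<in> {y} \<and> rand_assignment XR \<omega> = x \<and> rand_assignment ZR \<omega> = z})"
      \<comment> \<open>The four pieces cover the space because the randomizer variables take only
        the values 0 and 1.\<close>
      using bin(2,3) by (fastforce simp: rand_assignment_def split_beta)
    also have "\<dots> = (\<Union>x\<in>{0, 1}. \<Union>z\<in>{0, 1}.
        {\<omega> \<in> space M. Yp x z \<omega> \<in> {y}} \<times> {\<omega>R \<in> space R. XR \<omega>R = x \<and> ZR \<omega>R = z})"
      by (intro SUP_cong refl rand_outcome_rectangle)
    also have "\<dots> \<in> sets ?N"
      unfolding rand_space_def
      by (intro sets.finite_UN pair_measureI binary_rv_sets binary_rv_sets_pair assms) auto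
    finally show ?thesis .
  qed
  moreover have "?Y \<in> space ?N \<rightarrow> {0, 1}"
  proof
    fix \<omega> assume \<omega>: "\<omega> \<in> space ?N"
    show "?Y \<omega> \<in> {0, 1}"
      unfolding eq[OF \<omega>]
      by (rule binary_rv_range[OF assms(1)[OF bin(2,3)[OF \<omega>]] bin(1)[OF \<omega>]])
  qed
  ultimately show ?thesis
    unfolding binary_rv_def by (subst measurable_count_space_eq2) auto
qed

theorem theorem2:
  fixes M :: "'a measure" and X Z Y :: "'a \<Rightarrow> nat" and Yp :: "nat \<Rightarrow> nat \<Rightarrow> 'a \<Rightarrow> nat"
    and R :: "'b measure" and XR ZR :: "'b \<Rightarrow> nat"
    and N :: "('a \<times> 'b) measure" and Xt Zt Yt :: "'a \<times> 'b \<Rightarrow> nat"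
    and x z :: nat
  assumes "prob_space M"
    and "binary_rv M X" and "binary_rv M Z"
    and "\<And>x z. x \<in> {0, 1} \<Longrightarrow> z \<in> {0, 1} \<Longrightarrow> binary_rv M (Yp x z)"
    and "\<And>\<omega>. \<omega> \<in> space M \<Longrightarrow> Y \<omega> = observed_outcome M X Z Yp \<omega>"
    and "joint_randomizer R XR ZR"
    and "N = rand_space M R"
    and "Xt = rand_assignment XR" and "Zt = rand_assignment ZR"
    and "Yt = rand_outcome R XR ZR Yp"
    and "x \<in> {0, 1}" and "z \<in> {0, 1}"
  shows "law M (Yp x z) = cond_law N Yt (\<lambda>\<omega>. Xt \<omega> = x \<and> Zt \<omega> = z) \<and>
    (\<forall>y. \<P>(\<omega> in M. Yp x z \<omega> = y) = \<P>(\<omega> in N. Yt \<omega> = y \<bar> Xt \<omega> = x \<and> Zt \<omega> = z))"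
proof -
  let ?A = "{\<omega>R \<in> space R. XR \<omega>R = x \<and> ZR \<omega>R = z}"
  let ?C = "{\<omega> \<in> space N. Xt \<omega> = x \<and> Zt \<omega> = z}"
  have R: "prob_space R" "binary_rv R XR" "binary_rv R ZR" and pos: "measure R ?A > 0"
    using assms(6,11,12) by (auto simp: joint_randomizer_def)
  interpret M: prob_space M by fact
  interpret R: prob_space R by fact
  have Yp: "binary_rv M (Yp x z)"
    using assms(4,11,12) by blast
  have Yt: "binary_rv N Yt"
    unfolding assms(7,10) by (intro binary_rv_rand_outcome assms(4) R)
  have A: "?A \<in> sets R"
    by (intro binary_rv_sets_pair R)
  have rect: "{\<omega> \<in> space N. Yt \<omega> \<in> B \<and> Xt \<omega> = x \<and> Zt \<omega> = z} =
      {\<omega> \<in> space M. Yp x z \<omega> \<in> B} \<times> ?A" for B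
    unfolding assms(7-10) by (rule rand_outcome_rectangle[OF assms(11,12)])
  \<comment> \<open>With \<open>B = UNIV\<close> the outcome imposes no constraint, so the
    conditioning event is a full-width rectangle, of probability \<open>emeasure R ?A\<close>
    because \<open>M\<close> has total mass 1.\<close>
  have C: "?C = space M \<times> ?A"
    using rect[of UNIV] by simp
  have em: "emeasure N (E \<times> ?A) = emeasure M E * emeasure R ?A" if "E \<in> sets M" for E
    unfolding assms(7) rand_space_def using that A by (rule R.emeasure_pair_measure_Times)
  \<comment> \<open>Cancelling a factor in the extended nonnegative reals requires it to be both
    nonzero and finite.\<close>
  have posA: "emeasure R ?A \<noteq> 0" "emeasure R ?A \<noteq> \<infinity>"
    using pos by (auto simp: R.emeasure_eq_measure)
  have emC: "emeasure N ?C = emeasure R ?A"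
    unfolding C by (simp add: em M.emeasure_space_1)
  have C_sets: "?C \<in> sets N"
    unfolding C unfolding assms(7) rand_space_def using A by simp
  have ratio: "emeasure N (E \<times> ?A) / emeasure N ?C = emeasure M E" if "E \<in> sets M" for E
    unfolding emC em[OF that] using posA
    by (simp add: ennreal_mult_divide_eq)
  have "law M (Yp x z) = cond_law N Yt (\<lambda>\<omega>. Xt \<omega> = x \<and> Zt \<omega> = z)"
    unfolding law_def cond_law_def
  proof (rule measure_eqI)
    fix B assume "B \<in> sets (distr M (count_space {0, 1}) (Yp x z))"
    then have B: "B \<in> sets (count_space {0, 1})"
      by simp
    \<comment> \<open>Conditioning changes the measure but not the sigma-algebra, so measurability
      carries over.\<close>
    have Yt': "Yt \<in> uniform_measure N ?C \<rightarrow>\<^sub>M count_space {0, 1}"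
      using Yt by (simp add: binary_rv_def)
    have "emeasure (distr M (count_space {0, 1}) (Yp x z)) B =
        emeasure M {\<omega> \<in> space M. Yp x z \<omega> \<in> B}"
      using Yp B unfolding binary_rv_def
      by (subst emeasure_distr) (auto intro!: arg_cong[where f="emeasure M"])
    also have "\<dots> = emeasure N ({\<omega> \<in> space M. Yp x z \<omega> \<in> B} \<times> ?A) / emeasure N ?C"
      by (rule ratio[OF binary_rv_sets[OF Yp], symmetric])
    \<comment> \<open>The rectangle is now read as the conditioning event intersected with the
      preimage of \<open>B\<close>, the form in which \<open>uniform_measure\<close> evaluates an
      event.\<close>
    also have "{\<omega> \<in> space M. Yp x z \<omega> \<in> B} \<times> ?A = ?C \<inter> (Yt -` B \<inter> space N)"
      unfolding rect[symmetric] by auto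
    also have "emeasure N (?C \<inter> (Yt -` B \<inter> space N)) / emeasure N ?C =
        emeasure (uniform_measure N ?C) (Yt -` B \<inter> space N)"
      using C_sets measurable_sets[OF Yt[unfolded binary_rv_def] B] by simp
    also have "\<dots> = emeasure (distr (uniform_measure N ?C) (count_space {0, 1}) Yt) B"
      using emeasure_distr[OF Yt' B] by simp
    finally show "emeasure (distr M (count_space {0, 1}) (Yp x z)) B =
        emeasure (distr (uniform_measure N ?C) (count_space {0, 1}) Yt) B" .
  qed simp
  \<comment> \<open>The same cancellation is carried out with real-valued probabilities, where
    positivity of \<open>measure R ?A\<close> suffices. It covers every natural \<open>y\<close>
    uniformly; for \<open>y\<close> outside {0, 1} both sides are 0.\<close>
  moreover have "\<P>(\<omega> in M. Yp x z \<omega> = y) = \<P>(\<omega> in N. Yt \<omega> = y \<bar> Xt \<omega> = x \<and> Zt \<omega> = z)" for y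
  proof -
    have "measure N ({\<omega> \<in> space M. Yp x z \<omega> \<in> {y}} \<times> ?A) =
        measure M {\<omega> \<in> space M. Yp x z \<omega> \<in> {y}} * measure R ?A"
      unfolding measure_def em[OF binary_rv_sets[OF Yp]] by (rule enn2real_mult)
    moreover have "measure N ?C = measure R ?A"
      using emC by (simp add: measure_def)
    ultimately show ?thesis
      using pos rect[of "{y}"] by (simp add: cond_prob_def)
  qed
  ultimately show ?thesis
    by blast
qed

end
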